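(* One has $$\mathbb{K}\langle x_0,x_1\rangle=\mathrm{Vect}(x_1^n,\ n\ge0)\oplus\bigl(\mathbb{K}\langle x_0,x_1\rangle\bullet\mathbb{K}\langle x_0,x_1\rangle\bigr).$$ Hence $(x_1^n)_{n\ge0}$ is a minimal system of generators of the prelie algebra $(\mathbb{K}\langle x_0,x_1\rangle,\bullet)$.
   Context: $\mathbb{K}$ is a field of characteristic zero. A (right) prelie algebra is a vector space with a bilinear product $\bullet$ such that $(x\bullet y)\bullet z-x\bullet(y\bullet z)=(x\bullet z)\bullet y-x\bullet(z\bullet y)$. On $\mathbb{K}\langle x_0,x_1\rangle$ (span of words in $x_0,x_1$, $\emptyset$ being the empty word and $x_1^0=\emptyset$), $\sqcup\!\sqcup$ is the shuffle product, and $\bullet$ is the bilinear product determined inductively by: for all words $c,d$, $\emptyset\bullet d=0$, $(x_0c)\bullet d=x_0(c\bullet d)$, $(x_1c)\bullet d=x_1(c\bullet d)+x_0(c\sqcup\!\sqcup d)$. It is a prelie product. For a prelie algebra $A$, $A\bullet A$ is the subspace spanned by all products $a\bullet b$, $a,b\in A$. *)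

theory Defs
  imports Complex_Main "HOL-Library.Poly_Mapping"
begin

section \<open>Prelie algebras\<close>

locale prelie_algebra = vector_space scale
  for scale :: "'k::field \<Rightarrow> 'v::ab_group_add \<Rightarrow> 'v" +
  fixes prod :: "'v \<Rightarrow> 'v \<Rightarrow> 'v"  (infixl \<open>\<bullet>\<close> 70)
  assumes prod_add_left: "(x + y) \<bullet> z = x \<bullet> z + y \<bullet> z"
    and prod_add_right: "x \<bullet> (y + z) = x \<bullet> y + x \<bullet> z"
    and prod_scale_left: "scale c x \<bullet> y = scale c (x \<bullet> y)"
    and prod_scale_right: "x \<bullet> scale c y = scale c (x \<bullet> y)"
    and prelie: "(x \<bullet> y) \<bullet> z - x \<bullet> (y \<bullet> z) = (x \<bullet> z) \<bullet> y - x \<bullet> (z \<bullet> y)"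
begin

definition prod_space :: "'v set"
  where "prod_space = span {a \<bullet> b | a b. True}"

definition subalgebra :: "'v set \<Rightarrow> bool"
  where "subalgebra S \<longleftrightarrow> subspace S \<and> (\<forall>a\<in>S. \<forall>b\<in>S. a \<bullet> b \<in> S)"

definition generates :: "'v set \<Rightarrow> bool"
  where "generates S \<longleftrightarrow> subalgebra hull S = UNIV"

text \<open>Minimality refers to the index set, so that a minimal system of generators is
  in particular a family without repetitions.\<close>

definition minimal_generators :: "('i \<Rightarrow> 'v) \<Rightarrow> bool"
  where "minimal_generators g \<longleftrightarrow>
    generates (g ` UNIV) \<and> (\<forall>J. J \<subset> UNIV \<longrightarrow> \<not> generates (g ` J))"

end

context vector_space
begin

definition direct_sum_decomposition :: "'b set \<Rightarrow> 'b set \<Rightarrow> bool"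
  where "direct_sum_decomposition U W \<longleftrightarrow>
    subspace U \<and> subspace W \<and> {u + w | u w. u \<in> U \<and> w \<in> W} = UNIV \<and> U \<inter> W = {0}"

end


section \<open>Noncommutative polynomials in two letters\<close>

datatype letter = X0 | X1

type_synonym 'k ncpoly = "letter list \<Rightarrow>\<^sub>0 'k"

definition word :: "letter list \<Rightarrow> 'k::field ncpoly"
  where "word w = Poly_Mapping.single w 1"

definition x1_pow :: "nat \<Rightarrow> 'k::field ncpoly"
  where "x1_pow n = word (replicate n X1)"

definition nc_scale :: "'k::field \<Rightarrow> 'k ncpoly \<Rightarrow> 'k ncpoly"
  where "nc_scale c p = Poly_Mapping.map ((*) c) p"

definition lin_ext :: "(letter list \<Rightarrow> 'k::field ncpoly) \<Rightarrow> 'k ncpoly \<Rightarrow> 'k ncpoly"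
  where "lin_ext f p = (\<Sum>w\<in>Poly_Mapping.keys p. nc_scale (Poly_Mapping.lookup p w) (f w))"

definition bilin_ext ::
    "(letter list \<Rightarrow> letter list \<Rightarrow> 'k::field ncpoly) \<Rightarrow> 'k ncpoly \<Rightarrow> 'k ncpoly \<Rightarrow> 'k ncpoly"
  where "bilin_ext f p q = lin_ext (\<lambda>u. lin_ext (\<lambda>v. f u v) q) p"

definition lcons :: "letter \<Rightarrow> 'k::field ncpoly \<Rightarrow> 'k ncpoly"
  where "lcons a = lin_ext (\<lambda>w. word (a # w))"

text \<open>The library function \<^const>\<open>shuffles\<close> only yields the set of all shuffles of two lists;
  here multiplicities matter.\<close>

fun shuffle_word :: "letter list \<Rightarrow> letter list \<Rightarrow> 'k::field ncpoly"
  where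
    "shuffle_word [] v = word v"
  | "shuffle_word u [] = word u"
  | "shuffle_word (a # u) (b # v) =
      lcons a (shuffle_word u (b # v)) + lcons b (shuffle_word (a # u) v)"

fun bullet_word :: "letter list \<Rightarrow> letter list \<Rightarrow> 'k::field ncpoly"
  where
    "bullet_word [] d = 0"
  | "bullet_word (X0 # c) d = lcons X0 (bullet_word c d)"
  | "bullet_word (X1 # c) d = lcons X1 (bullet_word c d) + lcons X0 (shuffle_word c d)"

definition shuffle :: "'k::field ncpoly \<Rightarrow> 'k ncpoly \<Rightarrow> 'k ncpoly"
  where "shuffle = bilin_ext shuffle_word"

definition bullet :: "'k::field ncpoly \<Rightarrow> 'k ncpoly \<Rightarrow> 'k ncpoly"
  where "bullet = bilin_ext bullet_word"


section \<open>The prelie algebra of noncommutative polynomials\<close>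

lemma lookup_nc_scale: "Poly_Mapping.lookup (nc_scale c p) w = c * Poly_Mapping.lookup p w"
  by (simp add: nc_scale_def Poly_Mapping.map.rep_eq when_def)

interpretation ncp: vector_space nc_scale
  by unfold_locales
    (rule poly_mapping_eqI; simp add: lookup_nc_scale lookup_add algebra_simps)+

definition nclin :: "('k::field ncpoly \<Rightarrow> 'k ncpoly) \<Rightarrow> bool"
  where "nclin F \<longleftrightarrow> (\<forall>p q. F (p + q) = F p + F q) \<and> (\<forall>c p. F (nc_scale c p) = nc_scale c (F p))"

lemma nclinI:
  assumes "\<And>p q. F (p + q) = F p + F q" "\<And>c p. F (nc_scale c p) = nc_scale c (F p)"
  shows "nclin F"
  using assms by (simp add: nclin_def)

lemma lin_ext_superset:
  assumes "finite A" "Poly_Mapping.keys p \<subseteq> A"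
  shows "lin_ext f p = (\<Sum>w\<in>A. nc_scale (Poly_Mapping.lookup p w) (f w))"
  unfolding lin_ext_def
  by (rule sum.mono_neutral_left[OF assms]) (simp add: in_keys_iff)

lemma lin_ext_add: "lin_ext f (p + q) = lin_ext f p + lin_ext f q"
proof -
  let ?A = "Poly_Mapping.keys p \<union> Poly_Mapping.keys q"
  have "Poly_Mapping.keys (p + q) \<subseteq> ?A" by (rule keys_add)
  then show ?thesis
    by (simp add: lin_ext_superset[where A = ?A] lookup_add ncp.scale_left_distrib sum.distrib)
qed

lemma lin_ext_scale: "lin_ext f (nc_scale c p) = nc_scale c (lin_ext f p)"
proof -
  have "Poly_Mapping.keys (nc_scale c p) \<subseteq> Poly_Mapping.keys p"
    by (auto simp: in_keys_iff lookup_nc_scale)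
  then have "lin_ext f (nc_scale c p) =
      (\<Sum>w\<in>Poly_Mapping.keys p. nc_scale (Poly_Mapping.lookup (nc_scale c p) w) (f w))"
    by (intro lin_ext_superset) auto
  then show ?thesis
    by (simp add: lin_ext_def lookup_nc_scale ncp.scale_sum_right)
qed

lemma lin_ext_word: "lin_ext f (word w) = f w"
  by (simp add: lin_ext_def word_def)

lemma lin_ext_fun_add: "lin_ext (\<lambda>w. f w + g w) p = lin_ext f p + lin_ext g p"
  by (simp add: lin_ext_def ncp.scale_right_distrib sum.distrib)

lemma lin_ext_fun_scale: "lin_ext (\<lambda>w. nc_scale c (f w)) p = nc_scale c (lin_ext f p)"
  by (simp add: lin_ext_def ncp.scale_sum_right mult.commute)

lemma nclin_ext_eq:
  assumes "nclin F" "nclin G" "\<And>w. F (word w) = G (word w)"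
  shows "F p = G p"
proof (induction p rule: update_induct)
  case const
  show ?case
    using assms(1,2) unfolding nclin_def by (metis ncp.scale_zero_left)
next
  case (update p w c)
  have "Poly_Mapping.update w c p = p + nc_scale c (word w)"
    using update.hyps(1)
    by (intro poly_mapping_eqI)
      (auto simp: lookup_update lookup_add lookup_nc_scale word_def lookup_single when_def
        in_keys_iff)
  then show ?case
    using assms update unfolding nclin_def by metis
qed

lemma nclin_lin_ext: "nclin (lin_ext f)"
  by (intro nclinI lin_ext_add lin_ext_scale)

lemma bilin_ext_add_left: "bilin_ext f (p + q) r = bilin_ext f p r + bilin_ext f q r"
  and bilin_ext_add_right: "bilin_ext f r (p + q) = bilin_ext f r p + bilin_ext f r q"
  and bilin_ext_scale_left: "bilin_ext f (nc_scale c p) r = nc_scale c (bilin_ext f p r)"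
  and bilin_ext_scale_right: "bilin_ext f r (nc_scale c p) = nc_scale c (bilin_ext f r p)"
  and bilin_ext_word: "bilin_ext f (word u) (word v) = f u v"
  by (simp_all add: bilin_ext_def lin_ext_add lin_ext_scale lin_ext_fun_add lin_ext_fun_scale
      lin_ext_word)

lemmas shuffle_linear =
  bilin_ext_add_left[where f = shuffle_word, folded shuffle_def]
  bilin_ext_add_right[where f = shuffle_word, folded shuffle_def]
  bilin_ext_scale_left[where f = shuffle_word, folded shuffle_def]
  bilin_ext_scale_right[where f = shuffle_word, folded shuffle_def]

lemmas bullet_linear =
  bilin_ext_add_left[where f = bullet_word, folded bullet_def]
  bilin_ext_add_right[where f = bullet_word, folded bullet_def]
  bilin_ext_scale_left[where f = bullet_word, folded bullet_def]
  bilin_ext_scale_right[where f = bullet_word, folded bullet_def]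

lemma lcons_linear:
  "lcons a (p + q) = lcons a p + lcons a q" "lcons a (nc_scale c p) = nc_scale c (lcons a p)"
  by (simp_all add: lcons_def lin_ext_add lin_ext_scale)

lemma lcons_word: "lcons a (word w) = word (a # w)"
  by (simp add: lcons_def lin_ext_word)

lemmas nc_linear = shuffle_linear bullet_linear lcons_linear ncp.scale_right_distrib

lemma nc_zero [simp]:
  "shuffle 0 p = 0" "shuffle p 0 = 0" "bullet 0 p = 0" "bullet p 0 = 0" "lcons a 0 = 0"
  by (metis add_cancel_right_right nc_linear)+

lemma shuffle_word_Nil_right: "shuffle_word u [] = word u"
  by (cases u) auto

lemma shuffle_Nil [simp]: "shuffle (word []) p = p" "shuffle p (word []) = p"
proof -
  show "shuffle (word []) p = p"
    by (rule nclin_ext_eq[where p = p])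
      (auto intro!: nclinI simp: nc_linear shuffle_def bilin_ext_word
        bilin_ext_add_right bilin_ext_scale_right)
  show "shuffle p (word []) = p"
    by (rule nclin_ext_eq[where p = p])
      (auto intro!: nclinI simp: nc_linear shuffle_def bilin_ext_word shuffle_word_Nil_right
        bilin_ext_add_left bilin_ext_scale_left)
qed

lemma shuffle_lcons:
  "shuffle (lcons a p) (lcons b q) =
    lcons a (shuffle p (lcons b q)) + lcons b (shuffle (lcons a p) q)"
proof -
  have *: "shuffle (lcons a (word u)) (lcons b q) =
      lcons a (shuffle (word u) (lcons b q)) + lcons b (shuffle (lcons a (word u)) q)" for u q
    by (rule nclin_ext_eq[where p = q])
      (auto intro!: nclinI simp: nc_linear lcons_word, simp add: shuffle_def bilin_ext_word)
  show ?thesis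
    by (rule nclin_ext_eq[where p = p]) (auto intro!: nclinI simp: nc_linear *)
qed

lemma bullet_Nil [simp]: "bullet (word []) q = 0"
proof -
  have "lin_ext (bullet_word []) q = 0"
    by (simp add: lin_ext_def)
  then show ?thesis
    by (simp add: bullet_def bilin_ext_def lin_ext_word)
qed

lemma bullet_lcons_X0: "bullet (lcons X0 p) q = lcons X0 (bullet p q)"
proof -
  have *: "bullet (lcons X0 (word u)) q = lcons X0 (bullet (word u) q)" for u q
    by (rule nclin_ext_eq[where p = q])
      (auto intro!: nclinI simp: nc_linear lcons_word, simp add: bullet_def bilin_ext_word)
  show ?thesis
    by (rule nclin_ext_eq[where p = p]) (auto intro!: nclinI simp: nc_linear *)
qed

lemma bullet_lcons_X1:
  "bullet (lcons X1 p) q = lcons X1 (bullet p q) + lcons X0 (shuffle p q)"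
proof -
  have *: "bullet (lcons X1 (word u)) q =
      lcons X1 (bullet (word u) q) + lcons X0 (shuffle (word u) q)" for u q
    by (rule nclin_ext_eq[where p = q])
      (auto intro!: nclinI simp: nc_linear lcons_word,
        simp add: bullet_def shuffle_def bilin_ext_word)
  show ?thesis
    by (rule nclin_ext_eq[where p = p]) (auto intro!: nclinI simp: nc_linear *)
qed

lemma shuffle_word_commute: "shuffle_word u v = shuffle_word v u"
  by (induction u v rule: shuffle_word.induct) (auto simp: shuffle_word_Nil_right add.commute)

lemma shuffle_commute: "shuffle p q = shuffle q p"
proof -
  have *: "shuffle (word u) q = shuffle q (word u)" for u and q :: "'a ncpoly"
    by (rule nclin_ext_eq[where p = q])
      (auto intro!: nclinI simp: nc_linear, simp add: shuffle_def bilin_ext_word shuffle_word_commute)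
  show ?thesis
    by (rule nclin_ext_eq[where p = p]) (auto intro!: nclinI simp: nc_linear *)
qed

lemma shuffle_assoc_word:
  "shuffle (shuffle (word u) (word v)) (word w) =
    shuffle (word u) (shuffle (word v) (word w :: 'k::field ncpoly))"
proof (induction "length u + length v + length w" arbitrary: u v w rule: less_induct)
  case less
  show ?case
  proof (cases "u = [] \<or> v = [] \<or> w = []")
    case False
    then obtain a u' b v' c w' where uvw: "u = a # u'" "v = b # v'" "w = c # w'"
      by (meson neq_Nil_conv)
    have 1: "shuffle (shuffle (word u') (word v)) (word w) =
        shuffle (word u') (shuffle (word v) (word w :: 'k ncpoly))"
      by (rule less) (simp add: uvw)
    have 2: "shuffle (shuffle (word u) (word v')) (word w) =
        shuffle (word u) (shuffle (word v') (word w :: 'k ncpoly))"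
      by (rule less) (simp add: uvw)
    have 3: "shuffle (shuffle (word u) (word v)) (word w') =
        shuffle (word u) (shuffle (word v) (word w' :: 'k ncpoly))"
      by (rule less) (simp add: uvw)
    show ?thesis
      using 1 2 arg_cong[OF 3, of "lcons c"] unfolding uvw lcons_word[symmetric]
      by (simp add: shuffle_lcons nc_linear add_ac)
  qed auto
qed

lemma shuffle_assoc: "shuffle (shuffle p q) r = shuffle p (shuffle q r)"
proof -
  have 1: "shuffle (shuffle (word u) (word v)) r = shuffle (word u) (shuffle (word v) r)"
    for u v and r :: "'a ncpoly"
    by (rule nclin_ext_eq[where p = r])
      (auto intro!: nclinI simp: nc_linear shuffle_assoc_word)
  have 2: "shuffle (shuffle (word u) q) r = shuffle (word u) (shuffle q r)"
    for u and q r :: "'a ncpoly"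
    by (rule nclin_ext_eq[where p = q]) (auto intro!: nclinI simp: nc_linear 1)
  show ?thesis
    by (rule nclin_ext_eq[where p = p]) (auto intro!: nclinI simp: nc_linear 2)
qed

lemma shuffle_left_commute: "shuffle p (shuffle q r) = shuffle q (shuffle p r)"
  by (metis shuffle_assoc shuffle_commute)

lemma bullet_lcons_exists:
  "\<exists>\<epsilon>\<in>{0, 1}. \<forall>p q. bullet (lcons a p) q = lcons a (bullet p q) + nc_scale \<epsilon> (lcons X0 (shuffle p q))"
  by (cases a) (auto simp: bullet_lcons_X0 bullet_lcons_X1)

lemma bullet_shuffle_word:
  "bullet (shuffle (word u) (word v)) r =
    shuffle (bullet (word u) r) (word v) + shuffle (word u) (bullet (word v) r)"
proof (induction "length u + length v" arbitrary: u v rule: less_induct)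
  case less
  show ?case
  proof (cases "u = [] \<or> v = []")
    case False
    then obtain a u' b v' where uv: "u = a # u'" "v = b # v'"
      by (meson neq_Nil_conv)
    have 1: "bullet (shuffle (word u') (word v)) r =
        shuffle (bullet (word u') r) (word v) + shuffle (word u') (bullet (word v) r)"
      by (rule less) (simp add: uv)
    have 2: "bullet (shuffle (word u) (word v')) r =
        shuffle (bullet (word u) r) (word v') + shuffle (word u) (bullet (word v') r)"
      by (rule less) (simp add: uv)
    obtain s where s: "\<And>p q :: 'a ncpoly. bullet (lcons a p) q = lcons a (bullet p q) + nc_scale s (lcons X0 (shuffle p q))"
      using bullet_lcons_exists by metis
    obtain t where t: "\<And>p q :: 'a ncpoly. bullet (lcons b p) q = lcons b (bullet p q) + nc_scale t (lcons X0 (shuffle p q))"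
      using bullet_lcons_exists by metis
    show ?thesis
      using 1 2 unfolding uv lcons_word[symmetric]
      by (simp add: shuffle_lcons nc_linear s t shuffle_assoc shuffle_commute shuffle_left_commute
          algebra_simps)
  qed auto
qed

lemma bullet_shuffle:
  "bullet (shuffle p q) r = shuffle (bullet p r) q + shuffle p (bullet q r)"
proof -
  have *: "bullet (shuffle (word u) q) r = shuffle (bullet (word u) r) q + shuffle (word u) (bullet q r)"
    for u and q r :: "'a ncpoly"
    by (rule nclin_ext_eq[where p = q])
      (auto intro!: nclinI simp: nc_linear bullet_shuffle_word)
  show ?thesis
    by (rule nclin_ext_eq[where p = p]) (auto intro!: nclinI simp: nc_linear *)
qed

lemma bullet_prelie_word:
  "bullet (bullet (word u) q) r + bullet (word u) (bullet r q) =
    bullet (bullet (word u) r) q + bullet (word u) (bullet q r)"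
proof (induction u)
  case (Cons a u)
  note IH = arg_cong[OF Cons.IH, of "lcons a", unfolded nc_linear]
  show ?case
  proof (cases a)
    case X0
    then show ?thesis
      using IH by (simp add: lcons_word[symmetric] bullet_lcons_X0)
  next
    case X1
    have "shuffle (shuffle (word u) q) r = shuffle (shuffle (word u) r) q"
      by (metis shuffle_assoc shuffle_commute)
    then show ?thesis
      using IH X1
      by (simp add: lcons_word[symmetric] bullet_lcons_X0 bullet_lcons_X1 nc_linear
          bullet_shuffle algebra_simps)
  qed
qed simp

lemma bullet_prelie:
  "bullet (bullet p q) r - bullet p (bullet q r) = bullet (bullet p r) q - bullet p (bullet r q)"
proof -
  have "bullet (bullet p q) r + bullet p (bullet r q) = bullet (bullet p r) q + bullet p (bullet q r)"
    by (rule nclin_ext_eq[where p = p]) (auto intro!: nclinI simp: nc_linear bullet_prelie_word)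
  then show ?thesis
    by (simp add: algebra_simps)
qed

interpretation ncp: prelie_algebra nc_scale bullet
  by unfold_locales (simp_all add: nc_linear bullet_prelie)

end

theory Submission
  imports Defs
begin

text \<open>Since a product \<open>c \<bullet> d\<close> turns one letter \<open>x\<^sub>1\<close> of \<open>c\<close> into \<open>x\<^sub>0\<close>, all its words contain
  \<open>x\<^sub>0\<close>. Conversely, \<open>x\<^sub>1\<^sup>k\<^sup>+\<^sup>1 \<bullet> d\<close> is the sum over \<open>i \<le> k\<close> of
  \<open>x\<^sub>1\<^sup>i x\<^sub>0 (x\<^sub>1\<^sup>k\<^sup>-\<^sup>i \<squnion> d)\<close>, where \<open>\<squnion>\<close> is the shuffle product; its term for \<open>i = k\<close> is
  \<open>x\<^sub>1\<^sup>k x\<^sub>0 d\<close>. Hence, by induction on the number of leading letters \<open>x\<^sub>1\<close>, every word containing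
  \<open>x\<^sub>0\<close> is a combination of products \<open>x\<^sub>1\<^sup>k\<^sup>+\<^sup>1 \<bullet> d\<close> with \<open>d\<close> a shorter word.\<close>

lemma lin_ext_mem_subspace:
  assumes "ncp.subspace T" "\<And>w. w \<in> Poly_Mapping.keys p \<Longrightarrow> f w \<in> T"
  shows "lin_ext f p \<in> T"
  unfolding lin_ext_def using assms by (intro ncp.subspace_sum ncp.subspace_scale)

lemma lin_ext_word_id: "lin_ext word p = p"
  by (rule nclin_ext_eq[OF nclin_lin_ext, of "\<lambda>p. p"]) (auto intro: nclinI simp: lin_ext_word)

lemma mem_subspace_words:
  assumes "ncp.subspace T" "\<And>w. word w \<in> T"
  shows "p \<in> T"
  using lin_ext_mem_subspace[of T p word] assms by (simp add: lin_ext_word_id)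

text \<open>Distinct words are separated by their coefficients; this gives both the directness of
  the sum and the minimality of the generators.\<close>

lemma lookup_span_words:
  assumes "p \<in> ncp.span (word ` A)" "w \<notin> A"
  shows "Poly_Mapping.lookup p w = 0"
  using assms(1)
proof (induction rule: ncp.span_induct_alt)
  case (step c x y)
  then show ?case
    using assms(2) by (auto simp: lookup_add lookup_nc_scale word_def lookup_single when_def split: if_splits)
qed simp

lemma lcons_span_words:
  assumes "p \<in> ncp.span (word ` A)" "\<And>w. w \<in> A \<Longrightarrow> a # w \<in> B"
  shows "lcons a p \<in> ncp.span (word ` B)"
  using assms(1)
proof (induction rule: ncp.span_induct_alt)
  case (step c x y)
  then obtain w where "x = word w" "w \<in> A" by auto
  then have "lcons a x \<in> ncp.span (word ` B)"
    using assms(2) by (auto simp: lcons_word intro: ncp.span_base)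
  with step show ?case
    by (simp add: nc_linear ncp.span_add ncp.span_scale)
qed (simp add: ncp.span_zero)

text \<open>Each recursion step prefixes one letter. The grading supplies the length bookkeeping in
  \<open>bullet_x1_pow_leading\<close>.\<close>

lemma shuffle_word_length:
  "shuffle_word u v \<in> ncp.span (word ` {w. length w = length u + length v})"
proof (induction u v rule: shuffle_word.induct)
  case (3 a u b v)
  then show ?case
    by (auto intro!: ncp.span_add elim!: lcons_span_words)
qed (auto intro: ncp.span_base)

lemma bullet_word_X0:
  "bullet_word u v \<in> ncp.span (word ` {w. X0 \<in> set w})"
proof (induction u v rule: bullet_word.induct)
  case (2 c d)
  then show ?case by (auto elim: lcons_span_words)
next
  case (3 c d)
  then show ?case
    \<comment> \<open>The prefixed \<open>X0\<close> settles the shuffle term, whatever words the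
      shuffle contains.\<close>
    using lcons_span_words[OF shuffle_word_length[of c d], of X0 "{w. X0 \<in> set w}"]
    by (auto intro!: ncp.span_add elim: lcons_span_words)
qed (simp add: ncp.span_zero)

lemma bullet_X0: "bullet p q \<in> ncp.span (word ` {w. X0 \<in> set w})"
  unfolding bullet_def bilin_ext_def
  by (intro lin_ext_mem_subspace ncp.subspace_span bullet_word_X0)

lemma prod_space_X0: "ncp.prod_space \<subseteq> ncp.span (word ` {w. X0 \<in> set w})"
  unfolding ncp.prod_space_def
  by (rule ncp.span_minimal) (auto simp: bullet_X0)

lemma x1_pow_image: "x1_pow ` J = word ` ((\<lambda>n. replicate n X1) ` J)"
  by (auto simp: x1_pow_def image_def)

text \<open>Split at the first \<open>X0\<close>, if there is one; \<open>k\<close> counts the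
  letters \<open>X1\<close> before it.\<close>

lemma word_cases:
  obtains n where "w = replicate n X1" | k d where "w = replicate k X1 @ X0 # d"
proof (induction w arbitrary: thesis)
  case Nil
  then show ?case by (metis replicate_0)
next
  case (Cons a w)
  show ?case
  proof (cases a)
    case X0
    then show ?thesis using Cons.prems(2)[of 0 w] by simp
  next
    case X1
    show ?thesis
    proof (rule Cons.IH)
      fix n assume "w = replicate n X1"
      then show thesis using X1 Cons.prems(1)[of "Suc n"] by simp
    next
      fix k d assume "w = replicate k X1 @ X0 # d"
      then show thesis using X1 Cons.prems(2)[of "Suc k" d] by simp
    qed
  qed
qed

text \<open>One more letter \<open>X1\<close> shifts the old remainder from \<open>i\<close> to
  \<open>Suc i\<close> and adds a shuffle term with \<open>i = 0\<close>. The equation on lengths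
  says that all words have the length of the leading one.\<close>

lemma bullet_x1_pow_leading:
  "bullet_word (replicate (Suc k) X1) d - (word (replicate k X1 @ X0 # d) :: 'k::field ncpoly)
    \<in> ncp.span (word ` {replicate i X1 @ X0 # e | i e. i < k \<and> i + length e = k + length d})"
proof (induction k)
  case 0
  then show ?case by (simp add: lcons_word ncp.span_zero)
next
  case (Suc k)
  let ?W = "\<lambda>k. {replicate i X1 @ X0 # e | i e. i < k \<and> i + length e = k + length d}"
  have "lcons X1 (bullet_word (replicate (Suc k) X1) d - (word (replicate k X1 @ X0 # d) :: 'k ncpoly))
      \<in> ncp.span (word ` ?W (Suc k))"
  proof (rule lcons_span_words[OF Suc])
    fix w assume "w \<in> ?W k"
    then obtain i e where "w = replicate i X1 @ X0 # e" "i < k" "i + length e = k + length d"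
      by blast
    then show "X1 # w \<in> ?W (Suc k)"
      by (auto intro!: exI[of _ "Suc i"] exI[of _ e])
  qed
  \<comment> \<open>The shuffled words have length \<open>Suc k + length d\<close>, as required of
    \<open>e\<close> when \<open>i = 0\<close>.\<close>
  moreover have "lcons X0 (shuffle_word (replicate (Suc k) X1) d :: 'k ncpoly) \<in> ncp.span (word ` ?W (Suc k))"
    by (rule lcons_span_words[OF shuffle_word_length]) (auto intro!: exI[of _ 0])
  moreover have "bullet_word (replicate (Suc (Suc k)) X1) d - (word (replicate (Suc k) X1 @ X0 # d) :: 'k ncpoly) =
      lcons X1 (bullet_word (replicate (Suc k) X1) d - word (replicate k X1 @ X0 # d))
      + lcons X0 (shuffle_word (replicate (Suc k) X1) d)"
  proof -
    have "lcons X1 (p - q) = lcons X1 p - lcons X1 q" for p q :: "'k ncpoly"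
      by (metis add_diff_cancel_right' diff_add_cancel lcons_linear(1))
    then show ?thesis by (simp add: lcons_word)
  qed
  ultimately show ?case by (simp only: ncp.span_add)
qed

text \<open>The premise ranges over all \<open>i\<close> and \<open>e\<close> of the same total
  length, so it passes unchanged to the remainder words in the induction on \<open>k\<close>. It is
  applied to the product space and to subalgebras; for the latter the length equation makes
  \<open>e\<close> shorter than the word treated.\<close>

lemma word_mem_subspace:
  assumes T: "ncp.subspace T"
    and "\<And>i e. i + length e = k + length d \<Longrightarrow> bullet_word (replicate (Suc i) X1) e \<in> T"
  shows "word (replicate k X1 @ X0 # d) \<in> T"
  using assms(2)
proof (induction k arbitrary: d rule: less_induct)
  case (less k)
  let ?b = "bullet_word (replicate (Suc k) X1) d" and ?w = "word (replicate k X1 @ X0 # d)"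
  have "?b - ?w \<in> T"
  proof (rule subsetD[OF ncp.span_minimal[OF _ T] bullet_x1_pow_leading], clarify)
    fix i and e :: "letter list" assume "i < k" "i + length e = k + length d"
    with less show "word (replicate i X1 @ X0 # e) \<in> T" by metis
  qed
  moreover have "?b \<in> T" using less.prems by blast
  ultimately have "?b - (?b - ?w) \<in> T" by (rule ncp.subspace_diff[OF T, rotated])
  then show ?case by (simp only: diff_diff_eq2 add_diff_cancel_left')
qed

lemma bullet_word_eq: "bullet_word u v = bullet (word u) (word v)"
  by (simp add: bullet_def bilin_ext_word)

lemma x1_pow_direct_sum:
  "ncp.direct_sum_decomposition (ncp.span (range (x1_pow :: nat \<Rightarrow> 'k::field ncpoly))) ncp.prod_space"
proof -
  let ?U = "ncp.span (range (x1_pow :: nat \<Rightarrow> 'k ncpoly))" and ?W = "ncp.prod_space :: 'k ncpoly set"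
  have W: "ncp.subspace ?W" by (simp add: ncp.prod_space_def)
  have sum: "ncp.subspace {u + w |u w. u \<in> ?U \<and> w \<in> ?W}"
    using ncp.subspace_sums[OF ncp.subspace_span W] by simp
  have "word w \<in> {u + w |u w. u \<in> ?U \<and> w \<in> ?W}" for w
  proof (cases w rule: word_cases)
    case (1 n)
    then have "word w \<in> ?U" by (auto simp flip: x1_pow_def intro: ncp.span_base)
    then show ?thesis using ncp.subspace_0[OF W] by force
  next
    case (2 k d)
    have "word w \<in> ?W"
      unfolding 2 by (rule word_mem_subspace[OF W])
        (auto simp: bullet_word_eq ncp.prod_space_def intro!: ncp.span_base)
    then show ?thesis using ncp.span_zero[of "range x1_pow"] by force
  qed
  then have "{u + w |u w. u \<in> ?U \<and> w \<in> ?W} = UNIV"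
    using mem_subspace_words[OF sum] by blast
  moreover have "p = 0" if "p \<in> ?U" "p \<in> ?W" for p
  proof (rule poly_mapping_eqI)
    fix w
    \<comment> \<open>The two spans use disjoint sets of words, so one of the two memberships of
      \<open>p\<close> kills the coefficient at \<open>w\<close>.\<close>
    have "w \<notin> range (\<lambda>n. replicate n X1) \<or> w \<notin> {w. X0 \<in> set w}" by auto
    then show "Poly_Mapping.lookup p w = Poly_Mapping.lookup 0 w"
      using that prod_space_X0 lookup_span_words by (fastforce simp: x1_pow_image)
  qed
  moreover have "0 \<in> ?U" "0 \<in> ?W" by (simp_all add: ncp.span_zero ncp.subspace_0[OF W])
  ultimately show ?thesis
    using W by (auto simp: ncp.direct_sum_decomposition_def)
qed

lemma x1_pow_generates: "ncp.generates (range (x1_pow :: nat \<Rightarrow> 'k::field ncpoly))"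
proof -
  have "p \<in> S" if S: "ncp.subalgebra S" "range x1_pow \<subseteq> S" for S and p :: "'k ncpoly"
  proof (rule mem_subspace_words)
    show sub: "ncp.subspace S" using S by (simp add: ncp.subalgebra_def)
    show "word w \<in> S" for w
    proof (induction w rule: length_induct)
      case (1 w)
      show ?case
      proof (cases w rule: word_cases)
        case (1 n)
        then show ?thesis using S(2) by (auto simp: x1_pow_def)
      next
        case (2 k d)
        show ?thesis
          unfolding 2
        proof (rule word_mem_subspace[OF sub])
          fix i and e :: "letter list"
          assume "i + length e = k + length d"
          \<comment> \<open>Here \<open>length e \<le> k + length d < length w\<close>, so the
            induction hypothesis applies.\<close>
          then have "word e \<in> S" using 1 2 by simp
          moreover have "word (replicate (Suc i) X1) \<in> S"
            using S(2) unfolding x1_pow_def by blast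
          ultimately show "bullet_word (replicate (Suc i) X1) e \<in> S"
            using S(1) unfolding bullet_word_eq ncp.subalgebra_def by blast
        qed
      qed
    qed
  qed
  then show ?thesis
    by (auto simp: ncp.generates_def hull_def)
qed

text \<open>The span of all words except \<open>replicate n X1\<close> is a subalgebra, because
  products involve only words containing \<open>X0\<close>. It contains the remaining generators but
  misses \<open>x1_pow n\<close>.\<close>

lemma x1_pow_not_generates:
  assumes "n \<notin> J"
  shows "\<not> ncp.generates ((x1_pow :: nat \<Rightarrow> 'k::field ncpoly) ` J)"
proof
  let ?A = "- {replicate n X1}"
  let ?S = "ncp.span (word ` ?A) :: 'k ncpoly set"
  assume gen: "ncp.generates ((x1_pow :: nat \<Rightarrow> 'k ncpoly) ` J)"
  have "ncp.span (word ` {w. X0 \<in> set w}) \<subseteq> ?S"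
    by (intro ncp.span_mono image_mono) auto
  then have "ncp.subalgebra ?S"
    using bullet_X0 by (auto simp: ncp.subalgebra_def)
  moreover have "x1_pow ` J \<subseteq> ?S"
    using assms unfolding x1_pow_image
    by (intro order.trans[OF _ ncp.span_superset] image_mono) auto
  ultimately have "ncp.subalgebra hull (x1_pow ` J) \<subseteq> ?S"
    by (intro hull_minimal)
  then have "x1_pow n \<in> ?S"
    using gen unfolding ncp.generates_def by blast
  then have "Poly_Mapping.lookup (x1_pow n :: 'k ncpoly) (replicate n X1) = 0"
    by (rule lookup_span_words) simp
  then show False by (simp add: x1_pow_def word_def)
qed

theorem theorem12:
  "ncp.direct_sum_decomposition
      (ncp.span (range (x1_pow :: nat \<Rightarrow> 'k::field_char_0 ncpoly))) ncp.prod_space \<and>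
    ncp.minimal_generators (x1_pow :: nat \<Rightarrow> 'k ncpoly)"
  unfolding ncp.minimal_generators_def
  \<comment> \<open>A proper index set omits some \<open>n\<close>, and one omission already
    prevents generation.\<close>
  using x1_pow_direct_sum x1_pow_generates x1_pow_not_generates by blast

end
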